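(* Assume that $r_{ij}\ne0$ for all $i\neq j$ and $c_2<r_{21}+r_{23}$. Then $I^*=(y^{r_{12}}z^{r_{13}},\,y^{c_2},\,z^{c_3})$.
   Context: Let $K$ be a field and let $n_1<n_2<n_3$ be positive integers with $\gcd(n_1,n_2,n_3)=1$ that minimally generate the numerical semigroup $H=\langle n_1,n_2,n_3\rangle$. Let $S=K[x,y,z]$ with the standard grading, and let $I=I_H$ be the kernel of $S\to K[t]$, $x\mapsto t^{n_1}$, $y\mapsto t^{n_2}$, $z\mapsto t^{n_3}$. For nonzero $f\in S$, $f^*$ is its homogeneous component of smallest degree, and $I^*=(f^*\mid 0\neq f\in I)$. Let $c_1,c_2,c_3$ be the smallest positive integers such that $c_1n_1\in\langle n_2,n_3\rangle$, $c_2n_2\in\langle n_1,n_3\rangle$, $c_3n_3\in\langle n_1,n_2\rangle$, and let $r_{ij}$ be non-negative integers with $c_1n_1=r_{12}n_2+r_{13}n_3$, $c_2n_2=r_{21}n_1+r_{23}n_3$, $c_3n_3=r_{31}n_1+r_{32}n_2$. (The condition that all $r_{ij}$ are nonzero is the case where $I$ is not a complete intersection.) *)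

theory Defs
  imports
    Complex_Main
    "HOL-Library.Poly_Mapping"
    "HOL-Computational_Algebra.Polynomial"
begin

text \<open>The ideal generated by a set is its span in the ring regarded as a module over itself.\<close>

interpretation ideal: module "(*) :: 'a::comm_ring_1 \<Rightarrow> 'a \<Rightarrow> 'a"
  by unfold_locales (simp_all add: algebra_simps)

datatype xyz = X_ind | Y_ind | Z_ind

type_synonym monom3 = "xyz \<Rightarrow>\<^sub>0 nat"
type_synonym 'k mpoly3 = "monom3 \<Rightarrow>\<^sub>0 'k"

definition indet :: "xyz \<Rightarrow> 'k::field mpoly3" where
  "indet v = Poly_Mapping.single (Poly_Mapping.single v 1) 1"

definition mdeg :: "monom3 \<Rightarrow> nat" where
  "mdeg m = Poly_Mapping.lookup m X_ind + Poly_Mapping.lookup m Y_ind + Poly_Mapping.lookup m Z_ind"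

definition hom_component :: "nat \<Rightarrow> 'k::field mpoly3 \<Rightarrow> 'k mpoly3" where
  "hom_component d f =
     (\<Sum>m | m \<in> Poly_Mapping.keys f \<and> mdeg m = d. Poly_Mapping.single m (Poly_Mapping.lookup f m))"

text \<open>Only meaningful for nonzero polynomials: for zero no degree satisfies the condition.\<close>

definition initial_form :: "'k::field mpoly3 \<Rightarrow> 'k mpoly3" where
  "initial_form f = hom_component (LEAST d. hom_component d f \<noteq> 0) f"

definition initial_ideal :: "'k::field mpoly3 set \<Rightarrow> 'k mpoly3 set" where
  "initial_ideal I = ideal.span {initial_form f | f. f \<in> I \<and> f \<noteq> 0}"

lemma lookup_hom_component:
  "Poly_Mapping.lookup (hom_component d f) m = (Poly_Mapping.lookup f m when mdeg m = d)"
  by (simp add: hom_component_def lookup_sum lookup_single when_def in_keys_iff)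

definition subst_xyz :: "(xyz \<Rightarrow> 'k poly) \<Rightarrow> 'k::field mpoly3 \<Rightarrow> 'k poly" where
  "subst_xyz s f =
     (\<Sum>m\<in>Poly_Mapping.keys f. smult (Poly_Mapping.lookup f m)
        (s X_ind ^ Poly_Mapping.lookup m X_ind * s Y_ind ^ Poly_Mapping.lookup m Y_ind
          * s Z_ind ^ Poly_Mapping.lookup m Z_ind))"

definition semigroup_map :: "nat \<Rightarrow> nat \<Rightarrow> nat \<Rightarrow> 'k::field mpoly3 \<Rightarrow> 'k poly" where
  "semigroup_map n1 n2 n3 =
     subst_xyz (case_xyz (monom 1 n1) (monom 1 n2) (monom 1 n3))"

definition semigroup_ideal :: "nat \<Rightarrow> nat \<Rightarrow> nat \<Rightarrow> 'k::field mpoly3 set" where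
  "semigroup_ideal n1 n2 n3 = {f. semigroup_map n1 n2 n3 f = 0}"

lemma subst_xyz_superset:
  assumes "finite A" "Poly_Mapping.keys f \<subseteq> A"
  shows "subst_xyz s f =
     (\<Sum>m\<in>A. smult (Poly_Mapping.lookup f m)
        (s X_ind ^ Poly_Mapping.lookup m X_ind * s Y_ind ^ Poly_Mapping.lookup m Y_ind
          * s Z_ind ^ Poly_Mapping.lookup m Z_ind))"
  unfolding subst_xyz_def using assms by (intro sum.mono_neutral_left) (auto simp: in_keys_iff)

lemma subst_xyz_zero [simp]: "subst_xyz s 0 = 0"
  by (simp add: subst_xyz_def)

lemma subst_xyz_one [simp]: "subst_xyz s 1 = 1"
  by (simp add: subst_xyz_def)

lemma subst_xyz_indet [simp]: "subst_xyz s (indet v) = s v"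
  by (cases v) (simp_all add: subst_xyz_def indet_def lookup_single)

lemma subst_xyz_add: "subst_xyz s (f + g) = subst_xyz s f + subst_xyz s g"
proof -
  let ?A = "Poly_Mapping.keys f \<union> Poly_Mapping.keys g"
  have "Poly_Mapping.keys (f + g) \<subseteq> ?A"
    by (rule Poly_Mapping.keys_add)
  then show ?thesis
    by (simp add: subst_xyz_superset[of ?A] lookup_add smult_add_left sum.distrib)
qed

lemma subst_xyz_single:
  "subst_xyz s (Poly_Mapping.single m c) = smult c
     (s X_ind ^ Poly_Mapping.lookup m X_ind * s Y_ind ^ Poly_Mapping.lookup m Y_ind
       * s Z_ind ^ Poly_Mapping.lookup m Z_ind)"
  by (subst subst_xyz_superset[of "{m}"]) (auto simp: lookup_single)

lemma subst_xyz_sum: "subst_xyz s (sum f A) = (\<Sum>i\<in>A. subst_xyz s (f i))"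
  by (induction A rule: infinite_finite_induct) (simp_all add: subst_xyz_add)

lemma subst_xyz_mult: "subst_xyz s (f * g) = subst_xyz s f * subst_xyz s g"
proof -
  have expand: "h = (\<Sum>m\<in>Poly_Mapping.keys h. Poly_Mapping.single m (Poly_Mapping.lookup h m))"
    for h :: "'a mpoly3"
    by (rule poly_mapping_eqI) (auto simp: lookup_sum lookup_single when_def in_keys_iff)
  have single: "subst_xyz s (Poly_Mapping.single m a * Poly_Mapping.single n b) =
      subst_xyz s (Poly_Mapping.single m a) * subst_xyz s (Poly_Mapping.single n b)"
    for m n and a b :: 'a
    by (simp only: mult_single subst_xyz_single lookup_add power_add
        mult_smult_left mult_smult_right smult_smult mult.commute mult.left_commute mult.assoc)
  have "f * g = (\<Sum>m\<in>Poly_Mapping.keys f. \<Sum>n\<in>Poly_Mapping.keys g.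
      Poly_Mapping.single m (Poly_Mapping.lookup f m)
        * Poly_Mapping.single n (Poly_Mapping.lookup g n))"
    unfolding sum_product[symmetric] expand[symmetric] ..
  then have "subst_xyz s (f * g) = (\<Sum>m\<in>Poly_Mapping.keys f. \<Sum>n\<in>Poly_Mapping.keys g.
      subst_xyz s (Poly_Mapping.single m (Poly_Mapping.lookup f m))
        * subst_xyz s (Poly_Mapping.single n (Poly_Mapping.lookup g n)))"
    by (simp only: subst_xyz_sum single)
  also have "\<dots> = subst_xyz s f * subst_xyz s g"
    by (simp only: sum_product[symmetric] subst_xyz_sum[symmetric] expand[symmetric])
  finally show ?thesis .
qed

text \<open>Generated subsemigroups contain zero, as is customary for numerical semigroups.\<close>

inductive_set semigroup_gen :: "nat set \<Rightarrow> nat set" for G where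
  zero: "0 \<in> semigroup_gen G"
| add: "g \<in> G \<Longrightarrow> a \<in> semigroup_gen G \<Longrightarrow> g + a \<in> semigroup_gen G"

definition minimally_generates :: "nat set \<Rightarrow> nat set \<Rightarrow> bool" where
  "minimally_generates G H \<longleftrightarrow>
     semigroup_gen G = H \<and> (\<forall>G'. G' \<subset> G \<longrightarrow> semigroup_gen G' \<noteq> H)"

end

theory Submission
  imports Defs
begin

text \<open>
  Write \<open>J\<close> for the monomial ideal on the right-hand side and give the monomial
  \<open>x^a y^b z^c\<close> the weight \<open>a n1 + b n2 + c n3\<close>, the exponent of its image in \<open>K[t]\<close>.
  A polynomial lies in \<open>I\<close> if and only if, for each weight, the coefficients of its terms of that
  weight add up to zero.

  The three binomials \<open>y^r12 z^r13 - x^c1\<close>, \<open>y^c2 - x^r21 z^r23\<close>, \<open>z^c3 - x^r31 y^r32\<close> belong to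
  \<open>I\<close>, and in each of them the first term has the smaller degree: for the first and the last
  because \<open>n1\<close> is the smallest and \<open>n3\<close> the largest generator, for the second by the hypothesis
  \<open>c2 < r21 + r23\<close>.  So \<open>J\<close> is contained in the initial ideal.

  For the converse, replacing the first term of one of these binomials by the second inside a
  monomial of \<open>J\<close> keeps the weight and strictly raises the degree.  The degree is at most the
  weight, so the process ends at a monomial outside \<open>J\<close>; and by the minimality of \<open>c1\<close>, \<open>c2\<close>,
  \<open>c3\<close> there is at most one such monomial of each weight (\<open>standard_unique\<close>).  Hence a
  monomial outside \<open>J\<close> has strictly larger degree than every other monomial of its weight
  (\<open>standard_degree_maximal\<close>).  Such a monomial cannot occur in the initial form of an \<open>f\<close> in
  \<open>I\<close>: its coefficient in \<open>f\<close> has to be cancelled by another term of the same weight, and that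
  term would have degree below the lowest degree of \<open>f\<close>.  So every monomial of an initial form
  lies in \<open>J\<close>.
\<close>

section \<open>Exponent arithmetic\<close>

locale three_generator_relations =
  fixes n1 n2 n3 c1 c2 c3 r12 r13 r21 r23 r31 r32 :: nat
  assumes n1_pos: "0 < n1" and n1_less: "n1 < n2" and n2_less: "n2 < n3"
    and c1_minimal: "\<And>a p q. 0 < a \<Longrightarrow> a * n1 = p * n2 + q * n3 \<Longrightarrow> c1 \<le> a"
    and c2_minimal: "\<And>b p q. 0 < b \<Longrightarrow> b * n2 = p * n1 + q * n3 \<Longrightarrow> c2 \<le> b"
    and c3_minimal: "\<And>c p q. 0 < c \<Longrightarrow> c * n3 = p * n1 + q * n2 \<Longrightarrow> c3 \<le> c"
    and c1_rel: "c1 * n1 = r12 * n2 + r13 * n3"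
    and c2_rel: "c2 * n2 = r21 * n1 + r23 * n3"
    and c3_rel: "c3 * n3 = r31 * n1 + r32 * n2"
    and r12_pos: "0 < r12" and r31_pos: "0 < r31"
    and c2_degree: "c2 < r21 + r23"
begin

text \<open>
  These are the exponents of the monomials outside \<open>J\<close>.  The generators of \<open>J\<close> involve only \<open>y\<close>
  and \<open>z\<close>, so the exponent of \<open>x\<close> is no argument.
\<close>
definition standard :: "nat \<Rightarrow> nat \<Rightarrow> bool" where
  "standard b c \<longleftrightarrow> b < c2 \<and> c < c3 \<and> (b < r12 \<or> c < r13)"

lemma c1_degree: "r12 + r13 < c1"
proof -
  have "(r12 + r13) * n1 < r12 * n2 + r13 * n3"
    using r12_pos n1_less n2_less
    by (simp add: add_mult_distrib add_less_le_mono)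
  then show ?thesis
    using c1_rel by (metis mult_less_cancel2)
qed

lemma c3_degree: "c3 < r31 + r32"
proof -
  have "r31 * n1 + r32 * n2 < (r31 + r32) * n3"
    using r31_pos n1_less n2_less
    by (simp add: add_mult_distrib add_less_le_mono)
  then show ?thesis
    using c3_rel by (metis mult_less_cancel2)
qed

text \<open>
  A power of \<open>x\<close> cannot have the weight of a standard monomial in \<open>y\<close> and \<open>z\<close>.  Otherwise
  subtract the relation \<open>c1 n1 = r12 n2 + r13 n3\<close>.  If \<open>b < r12\<close>, the term in \<open>n2\<close> changes
  sides and \<open>(c - r13) n3\<close> becomes a combination of \<open>n1\<close> and \<open>n2\<close> with \<open>0 < c - r13 < c3\<close>,
  against the minimality of \<open>c3\<close>; if \<open>c < r13\<close>, the minimality of \<open>c2\<close> is violated in the same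
  way.
\<close>
lemma x_power_not_standard:
  assumes "0 < a" "a * n1 = b * n2 + c * n3"
  shows "\<not> standard b c"
proof
  assume std: "standard b c"
  have "c1 \<le> a"
    using c1_minimal assms by blast
  then obtain p where p: "a = c1 + p"
    using le_Suc_ex by blast
  have eq: "p * n1 + r12 * n2 + r13 * n3 = b * n2 + c * n3"
    using assms(2) c1_rel by (simp add: p algebra_simps)
  from std consider "b < r12" | "c < r13"
    by (auto simp: standard_def)
  then show False
  proof cases
    case 1
    then obtain q where q: "r12 = b + q" "0 < q"
      using less_imp_add_positive by blast
    have *: "p * n1 + q * n2 + r13 * n3 = c * n3"
      using eq by (simp add: q algebra_simps)
    have "0 < q * n2"
      using q n1_less by simp
    then have "r13 * n3 < c * n3"
      using * by linarith
    then have "r13 < c"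
      by simp
    then obtain s where s: "c = r13 + s" "0 < s"
      using less_imp_add_positive by blast
    have "s * n3 = p * n1 + q * n2"
      using * by (simp add: s algebra_simps)
    then have "c3 \<le> s"
      using c3_minimal s by blast
    then show False
      using std s by (simp add: standard_def)
  next
    case 2
    then obtain q where q: "r13 = c + q" "0 < q"
      using less_imp_add_positive by blast
    have *: "p * n1 + r12 * n2 + q * n3 = b * n2"
      using eq by (simp add: q algebra_simps)
    have "0 < q * n3"
      using q n2_less by simp
    then have "r12 * n2 < b * n2"
      using * by linarith
    then have "r12 < b"
      by simp
    then obtain s where s: "b = r12 + s" "0 < s"
      using less_imp_add_positive by blast
    have "s * n2 = p * n1 + q * n3"
      using * by (simp add: s algebra_simps)
    then have "c2 \<le> s"
      using c2_minimal s by blast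
    then show False
      using std s by (simp add: standard_def)
  qed
qed

lemma standard_mono: "standard b c \<Longrightarrow> b' \<le> b \<Longrightarrow> c' \<le> c \<Longrightarrow> standard b' c'"
  by (auto simp: standard_def)

text \<open>
  After cancelling the common factor of two monomials of equal weight, one side is a power of a
  single variable; minimality of the corresponding \<open>c\<close> then excludes that both are standard.
\<close>
lemma standard_unique:
  assumes std: "standard b c" "standard b' c'"
    and eq: "a * n1 + b * n2 + c * n3 = a' * n1 + b' * n2 + c' * n3"
  shows "a = a' \<and> b = b' \<and> c = c'"
proof -
  have x: "\<not> (a' < a \<and> b \<le> b' \<and> c \<le> c')"
    if std: "standard b' c'"
      and eq: "a * n1 + b * n2 + c * n3 = a' * n1 + b' * n2 + c' * n3" for a b c a' b' c'
  proof
    assume *: "a' < a \<and> b \<le> b' \<and> c \<le> c'"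
    define p q s where "p = a - a'" "q = b' - b" "s = c' - c"
    then have d: "a = a' + p" "0 < p" "b' = b + q" "c' = c + s"
      using * by auto
    have "p * n1 = q * n2 + s * n3"
      using eq by (simp add: d algebra_simps)
    then have "\<not> standard q s"
      using x_power_not_standard d by blast
    then show False
      using standard_mono[OF std, of q s] d by simp
  qed
  have y: "\<not> (b' < b \<and> a \<le> a' \<and> c \<le> c')"
    if std: "standard b c"
      and eq: "a * n1 + b * n2 + c * n3 = a' * n1 + b' * n2 + c' * n3" for a b c a' b' c'
  proof
    assume *: "b' < b \<and> a \<le> a' \<and> c \<le> c'"
    define p q s where "p = b - b'" "q = a' - a" "s = c' - c"
    then have d: "b = b' + p" "0 < p" "a' = a + q" "c' = c + s"
      using * by auto
    have "p * n2 = q * n1 + s * n3"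
      using eq by (simp add: d algebra_simps)
    then have "c2 \<le> p"
      using c2_minimal d by blast
    then show False
      using std d by (simp add: standard_def)
  qed
  have z: "\<not> (c' < c \<and> a \<le> a' \<and> b \<le> b')"
    if std: "standard b c"
      and eq: "a * n1 + b * n2 + c * n3 = a' * n1 + b' * n2 + c' * n3" for a b c a' b' c'
  proof
    assume *: "c' < c \<and> a \<le> a' \<and> b \<le> b'"
    define p q s where "p = c - c'" "q = a' - a" "s = b' - b"
    then have d: "c = c' + p" "0 < p" "a' = a + q" "b' = b + s"
      using * by auto
    have "p * n3 = q * n1 + s * n2"
      using eq by (simp add: d algebra_simps)
    then have "c3 \<le> p"
      using c3_minimal d by blast
    then show False
      using std d by (simp add: standard_def)
  qed
  have all_le: "a = a' \<and> b = b' \<and> c = c'"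
    if "a \<le> a'" "b \<le> b'" "c \<le> c'"
      and "a * n1 + b * n2 + c * n3 = a' * n1 + b' * n2 + c' * n3" for a b c a' b' c'
  proof -
    define p q s where "p = a' - a" "q = b' - b" "s = c' - c"
    then have d: "a' = a + p" "b' = b + q" "c' = c + s"
      using that(1-3) by auto
    have "p * n1 + q * n2 + s * n3 = 0"
      using that(4) by (simp add: d algebra_simps)
    then show ?thesis
      using d n1_pos n1_less n2_less by simp
  qed
  \<comment> \<open>If neither side divided the other, one of them would be strictly larger in exactly one
    of the three exponents, which the three facts above exclude.\<close>
  have "(a \<le> a' \<and> b \<le> b' \<and> c \<le> c') \<or> (a' \<le> a \<and> b' \<le> b \<and> c' \<le> c)"
    using x[OF std(2) eq] x[OF std(1) eq[symmetric]]
      y[OF std(1) eq] y[OF std(2) eq[symmetric]]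
      z[OF std(1) eq] z[OF std(2) eq[symmetric]]
      linear[of a a'] linear[of b b'] linear[of c c']
    unfolding not_le[symmetric] by argo
  then show ?thesis
    using all_le[of a a' b b' c c'] all_le[of a' a b' b c' c] eq by auto
qed

text \<open>
  Exchange the first term of one of the three binomials for the second.  Iterated, this leads to
  a monomial outside \<open>J\<close>, because the weight bounds the degree.
\<close>
lemma not_standard_raise_degree:
  assumes "\<not> standard b c"
  obtains a' b' c' where
    "a' * n1 + b' * n2 + c' * n3 = a * n1 + b * n2 + c * n3" "a + b + c < a' + b' + c'"
proof -
  from assms consider "c2 \<le> b" | "c3 \<le> c" | "r12 \<le> b" "r13 \<le> c"
    by (auto simp: standard_def not_less)
  then show ?thesis
  proof cases
    case 1
    then obtain p where "b = c2 + p"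
      using le_Suc_ex by blast
    then show ?thesis
      using c2_rel c2_degree by (intro that[of "a + r21" p "c + r23"]) (auto simp: algebra_simps)
  next
    case 2
    then obtain p where "c = c3 + p"
      using le_Suc_ex by blast
    then show ?thesis
      using c3_rel c3_degree by (intro that[of "a + r31" "b + r32" p]) (auto simp: algebra_simps)
  next
    case 3
    then obtain p q where "b = r12 + p" "c = r13 + q"
      using le_Suc_ex by metis
    then show ?thesis
      using c1_rel c1_degree by (intro that[of "a + c1" p q]) (auto simp: algebra_simps)
  qed
qed

lemma degree_le_weight: "a + b + c \<le> a * n1 + b * n2 + c * n3"
proof -
  have "a * 1 \<le> a * n1" "b * 1 \<le> b * n2" "c * 1 \<le> c * n3"
    using n1_pos n1_less n2_less by (intro mult_le_mono2; simp)+
  then show ?thesis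
    unfolding mult_1_right by linarith
qed

lemma standard_degree_maximal:
  assumes std: "standard b c"
    and "a' * n1 + b' * n2 + c' * n3 = a * n1 + b * n2 + c * n3"
    and "(a', b', c') \<noteq> (a, b, c)"
  shows "a' + b' + c' < a + b + c"
  using assms(2,3)
proof (induction "a * n1 + b * n2 + c * n3 - (a' + b' + c')" arbitrary: a' b' c' rule: less_induct)
  case less
  have "\<not> standard b' c'"
    using standard_unique[OF std _ less.prems(1)[symmetric]] less.prems(2) by blast
  then obtain a'' b'' c'' where step:
      "a'' * n1 + b'' * n2 + c'' * n3 = a' * n1 + b' * n2 + c' * n3"
      "a' + b' + c' < a'' + b'' + c''"
    by (rule not_standard_raise_degree)
  show ?case
  proof (cases "(a'', b'', c'') = (a, b, c)")
    case True
    then show ?thesis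
      using step(2) by simp
  next
    case False
    have "a'' + b'' + c'' \<le> a * n1 + b * n2 + c * n3"
      using degree_le_weight[of a'' b'' c''] step(1) less.prems(1) by simp
    then have "a'' + b'' + c'' < a + b + c"
      using less.hyps[of a'' b'' c''] step less.prems(1) False by simp
    then show ?thesis
      using step(2) by simp
  qed
qed

end

section \<open>Initial forms and the semigroup ideal\<close>

definition weight :: "nat \<Rightarrow> nat \<Rightarrow> nat \<Rightarrow> monom3 \<Rightarrow> nat" where
  "weight n1 n2 n3 m =
     Poly_Mapping.lookup m X_ind * n1 + Poly_Mapping.lookup m Y_ind * n2
       + Poly_Mapping.lookup m Z_ind * n3"

lemma monom3_eqI:
  fixes m m' :: monom3
  assumes "Poly_Mapping.lookup m X_ind = Poly_Mapping.lookup m' X_ind"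
    "Poly_Mapping.lookup m Y_ind = Poly_Mapping.lookup m' Y_ind"
    "Poly_Mapping.lookup m Z_ind = Poly_Mapping.lookup m' Z_ind"
  shows "m = m'"
proof (rule poly_mapping_eqI)
  show "Poly_Mapping.lookup m v = Poly_Mapping.lookup m' v" for v
    using assms by (cases v) simp_all
qed

lemma semigroup_map_eq:
  "semigroup_map n1 n2 n3 f =
     (\<Sum>m\<in>Poly_Mapping.keys f. monom (Poly_Mapping.lookup f m) (weight n1 n2 n3 m))"
  by (simp add: semigroup_map_def subst_xyz_def monom_power mult_monom smult_monom weight_def
      mult_ac add_ac)

lemma semigroup_ideal_coeff_sum:
  assumes "f \<in> semigroup_ideal n1 n2 n3"
  shows "(\<Sum>m | m \<in> Poly_Mapping.keys f \<and> weight n1 n2 n3 m = w. Poly_Mapping.lookup f m) = 0"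
proof -
  have "coeff (semigroup_map n1 n2 n3 f) w = 0"
    using assms by (simp add: semigroup_ideal_def)
  then show ?thesis
    by (simp add: semigroup_map_eq coeff_sum sum.If_cases Int_def)
qed

lemma monomial_diff_in_semigroup_ideal:
  assumes "weight n1 n2 n3 u = weight n1 n2 n3 v"
  shows "(Poly_Mapping.single u 1 - Poly_Mapping.single v 1 :: 'k::field mpoly3)
     \<in> semigroup_ideal n1 n2 n3"
proof -
  have single: "semigroup_map n1 n2 n3 (Poly_Mapping.single m c) = monom c (weight n1 n2 n3 m)"
    for m and c :: 'k
    by (simp add: semigroup_map_eq)
  have "(Poly_Mapping.single u 1 - Poly_Mapping.single v 1 :: 'k mpoly3) =
      Poly_Mapping.single u 1 + Poly_Mapping.single v (-1)"
    by (simp add: single_uminus)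
  then have "semigroup_map n1 n2 n3 (Poly_Mapping.single u 1 - Poly_Mapping.single v 1 :: 'k mpoly3) =
      semigroup_map n1 n2 n3 (Poly_Mapping.single u 1)
        + semigroup_map n1 n2 n3 (Poly_Mapping.single v (-1))"
    by (simp only: semigroup_map_def subst_xyz_add)
  also have "\<dots> = 0"
    using assms by (simp add: single add_monom)
  finally show ?thesis
    by (simp add: semigroup_ideal_def)
qed

lemma lookup_initial_form_nonzero:
  assumes "Poly_Mapping.lookup (initial_form f) m \<noteq> 0"
  shows "Poly_Mapping.lookup f m \<noteq> 0"
    and "\<And>m'. Poly_Mapping.lookup f m' \<noteq> 0 \<Longrightarrow> mdeg m \<le> mdeg m'"
proof -
  let ?d = "LEAST d. hom_component d f \<noteq> 0"
  have m: "mdeg m = ?d" "Poly_Mapping.lookup f m \<noteq> 0"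
    using assms by (auto simp: initial_form_def lookup_hom_component when_def split: if_splits)
  then show "Poly_Mapping.lookup f m \<noteq> 0"
    by simp
  fix m' assume "Poly_Mapping.lookup f m' \<noteq> 0"
  then have "Poly_Mapping.lookup (hom_component (mdeg m') f) m' \<noteq> 0"
    by (simp add: lookup_hom_component)
  then have "hom_component (mdeg m') f \<noteq> 0"
    by auto
  then show "mdeg m \<le> mdeg m'"
    unfolding m(1) by (rule Least_le)
qed

lemma monomial_nonzero: "(Poly_Mapping.single u 1 :: 'k::field mpoly3) \<noteq> 0"
proof
  assume "(Poly_Mapping.single u 1 :: 'k mpoly3) = 0"
  then have "Poly_Mapping.lookup (Poly_Mapping.single u 1 :: 'k mpoly3) u = 0"
    by simp
  then show False
    by simp
qed

lemma initial_form_monomial_diff: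
  assumes "mdeg u < mdeg v"
  shows "initial_form (Poly_Mapping.single u 1 - Poly_Mapping.single v 1 :: 'k::field mpoly3) =
    Poly_Mapping.single u 1"
proof -
  let ?f = "Poly_Mapping.single u 1 - Poly_Mapping.single v 1 :: 'k mpoly3"
  have comp: "hom_component d ?f =
      (if d = mdeg u then Poly_Mapping.single u 1
       else if d = mdeg v then - Poly_Mapping.single v 1 else 0)" for d
    using assms
    by (intro poly_mapping_eqI)
      (auto simp: lookup_hom_component lookup_minus lookup_single when_def)
  have "(LEAST d. hom_component d ?f \<noteq> 0) = mdeg u"
    using assms by (intro Least_equality) (auto simp: comp monomial_nonzero split: if_splits)
  then show ?thesis
    by (simp add: initial_form_def comp)
qed

lemma monomial_diff_initial_ideal:
  assumes "weight n1 n2 n3 u = weight n1 n2 n3 v" "mdeg u < mdeg v"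
  shows "(Poly_Mapping.single u 1 :: 'k::field mpoly3)
    \<in> initial_ideal (semigroup_ideal n1 n2 n3)"
proof -
  let ?f = "Poly_Mapping.single u 1 - Poly_Mapping.single v 1 :: 'k mpoly3"
  have "initial_form ?f \<noteq> 0"
    by (simp add: initial_form_monomial_diff[OF assms(2)] monomial_nonzero)
  then have "?f \<noteq> 0"
    by (auto simp: initial_form_def hom_component_def)
  then have "initial_form ?f \<in> initial_ideal (semigroup_ideal n1 n2 n3)"
    unfolding initial_ideal_def
    using monomial_diff_in_semigroup_ideal[OF assms(1)] by (intro ideal.span_base) blast
  then show ?thesis
    by (simp add: initial_form_monomial_diff[OF assms(2)])
qed

lemma indet_power: "(indet v ^ n :: 'k::field mpoly3) =
    Poly_Mapping.single (Poly_Mapping.single v n) 1"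
  by (induction n) (simp_all add: indet_def mult_single flip: single_add)

lemma in_span_if_monomials_divisible:
  fixes f :: "'k::field mpoly3"
  assumes "\<And>m. Poly_Mapping.lookup f m \<noteq> 0 \<Longrightarrow>
    \<exists>u v. m = u + v \<and> Poly_Mapping.single u 1 \<in> B"
  shows "f \<in> ideal.span B"
proof -
  have "Poly_Mapping.single m (Poly_Mapping.lookup f m) \<in> ideal.span B"
    if m: "m \<in> Poly_Mapping.keys f" for m
  proof -
    obtain u v where uv: "m = u + v" "Poly_Mapping.single u 1 \<in> B"
      using assms[of m] m by (auto simp: in_keys_iff)
    have "Poly_Mapping.single m (Poly_Mapping.lookup f m) =
        Poly_Mapping.single v (Poly_Mapping.lookup f m) * Poly_Mapping.single u 1"
      by (simp add: uv(1) mult_single add.commute)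
    then show ?thesis
      using uv(2) by (simp add: ideal.span_base ideal.span_scale)
  qed
  then have "(\<Sum>m\<in>Poly_Mapping.keys f. Poly_Mapping.single m (Poly_Mapping.lookup f m))
      \<in> ideal.span B"
    by (rule ideal.span_sum)
  moreover have "(\<Sum>m\<in>Poly_Mapping.keys f. Poly_Mapping.single m (Poly_Mapping.lookup f m)) = f"
    by (rule poly_mapping_eqI) (auto simp: lookup_sum lookup_single when_def in_keys_iff)
  ultimately show ?thesis
    by simp
qed

lemma monom3_split:
  fixes m :: monom3
  assumes "b \<le> Poly_Mapping.lookup m Y_ind" "c \<le> Poly_Mapping.lookup m Z_ind"
  shows "\<exists>v. m = Poly_Mapping.single Y_ind b + Poly_Mapping.single Z_ind c + v"
proof
  show "m = Poly_Mapping.single Y_ind b + Poly_Mapping.single Z_ind c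
      + (m - (Poly_Mapping.single Y_ind b + Poly_Mapping.single Z_ind c))"
    using assms by (intro monom3_eqI) (simp_all add: lookup_add lookup_minus lookup_single)
qed

section \<open>The initial ideal\<close>

context three_generator_relations
begin

text \<open>
  A polynomial of \<open>I\<close> has at least two terms in every weight that occurs in it, and the standard
  monomial, having the largest degree of its weight, is then not among the terms of lowest degree.
\<close>
lemma initial_form_monomial_not_standard:
  fixes f :: "'k::field mpoly3"
  assumes f: "f \<in> semigroup_ideal n1 n2 n3"
    and m: "Poly_Mapping.lookup (initial_form f) m \<noteq> 0"
  shows "\<not> standard (Poly_Mapping.lookup m Y_ind) (Poly_Mapping.lookup m Z_ind)"
proof
  assume std: "standard (Poly_Mapping.lookup m Y_ind) (Poly_Mapping.lookup m Z_ind)"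
  let ?A = "{m' \<in> Poly_Mapping.keys f. weight n1 n2 n3 m' = weight n1 n2 n3 m}"
  have nz: "Poly_Mapping.lookup f m \<noteq> 0"
    using lookup_initial_form_nonzero(1)[OF m] .
  have "\<exists>m'\<in>?A. m' \<noteq> m"
  proof (rule ccontr)
    assume "\<not> ?thesis"
    then have "?A = {m}"
      using nz by (auto simp: in_keys_iff)
    then show False
      using semigroup_ideal_coeff_sum[OF f, of "weight n1 n2 n3 m"] nz by simp
  qed
  then obtain m' where m': "Poly_Mapping.lookup f m' \<noteq> 0"
      "weight n1 n2 n3 m' = weight n1 n2 n3 m" "m' \<noteq> m"
    by (auto simp: in_keys_iff)
  have "mdeg m' < mdeg m"
    unfolding mdeg_def
    using m'(2,3) monom3_eqI[of m' m]
    by (intro standard_degree_maximal[OF std]) (auto simp: weight_def)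
  then show False
    using lookup_initial_form_nonzero(2)[OF m m'(1)] by simp
qed

lemma initial_ideal_eq:
  "initial_ideal (semigroup_ideal n1 n2 n3) =
    ideal.span {indet Y_ind ^ r12 * indet Z_ind ^ r13, indet Y_ind ^ c2,
      indet Z_ind ^ c3 :: 'k::field mpoly3}"
  (is "?L = ideal.span ?B")
proof
  define mon :: "nat \<Rightarrow> nat \<Rightarrow> nat \<Rightarrow> monom3" where
    "mon = (\<lambda>a b c. Poly_Mapping.single X_ind a + Poly_Mapping.single Y_ind b
       + Poly_Mapping.single Z_ind c)"
  have [simp]: "weight n1 n2 n3 (mon a b c) = a * n1 + b * n2 + c * n3"
      "mdeg (mon a b c) = a + b + c" for a b c
    by (simp_all add: mon_def weight_def mdeg_def lookup_add lookup_single)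
  have B: "?B = {Poly_Mapping.single (mon 0 r12 r13) 1, Poly_Mapping.single (mon 0 c2 0) 1,
      Poly_Mapping.single (mon 0 0 c3) 1}"
    by (simp add: mon_def indet_power mult_single)
  have "?B \<subseteq> ?L"
    using monomial_diff_initial_ideal[of n1 n2 n3 "mon 0 r12 r13" "mon c1 0 0"]
      monomial_diff_initial_ideal[of n1 n2 n3 "mon 0 c2 0" "mon r21 0 r23"]
      monomial_diff_initial_ideal[of n1 n2 n3 "mon 0 0 c3" "mon r31 r32 0"]
      c1_rel c1_degree c2_rel c2_degree c3_rel c3_degree
    unfolding B by simp
  then show "ideal.span ?B \<subseteq> ?L"
    unfolding initial_ideal_def by (rule ideal.span_minimal[OF _ ideal.subspace_span])
  have "initial_form f \<in> ideal.span ?B" if f: "f \<in> semigroup_ideal n1 n2 n3" for f :: "'k mpoly3"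
  proof (rule in_span_if_monomials_divisible)
    fix m assume m: "Poly_Mapping.lookup (initial_form f) m \<noteq> 0"
    have split: "\<exists>v. m = mon 0 b c + v"
      if "b \<le> Poly_Mapping.lookup m Y_ind" "c \<le> Poly_Mapping.lookup m Z_ind" for b c
      using monom3_split[OF that] by (simp add: mon_def)
    from initial_form_monomial_not_standard[OF f m]
    consider "c2 \<le> Poly_Mapping.lookup m Y_ind" | "c3 \<le> Poly_Mapping.lookup m Z_ind"
      | "r12 \<le> Poly_Mapping.lookup m Y_ind" "r13 \<le> Poly_Mapping.lookup m Z_ind"
      by (auto simp: standard_def not_less)
    then show "\<exists>u v. m = u + v \<and> Poly_Mapping.single u 1 \<in> ?B"
    proof cases
      case 1
      then show ?thesis
        using split[of c2 0] unfolding B by blast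
    next
      case 2
      then show ?thesis
        using split[of 0 c3] unfolding B by blast
    next
      case 3
      then show ?thesis
        using split[of r12 r13] unfolding B by blast
    qed
  qed
  then show "?L \<subseteq> ideal.span ?B"
    unfolding initial_ideal_def by (intro ideal.span_minimal) (auto simp: ideal.subspace_span)
qed

end

lemma semigroup_gen_pair: "p * a + q * b \<in> semigroup_gen {a, b}"
proof -
  have "q * b \<in> semigroup_gen {a, b}"
    by (induction q) (auto intro: semigroup_gen.intros)
  then show ?thesis
    by (induction p) (auto intro: semigroup_gen.intros simp: add.assoc)
qed

lemma Least_multiple_le:
  assumes "0 < k" "k * n = p * a + q * b"
  shows "(LEAST c. 0 < c \<and> c * n \<in> semigroup_gen {a, b}) \<le> k"
  using assms semigroup_gen_pair[of p a q b] by (intro Least_le) simp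

theorem lemma4p1:
  fixes n1 n2 n3 c1 c2 c3 r12 r13 r21 r23 r31 r32 :: nat
    and H :: "nat set"
    and I :: "'k::field mpoly3 set"
  assumes "0 < n1" and "n1 < n2" and "n2 < n3"
    and "Gcd {n1, n2, n3} = 1"
    and "minimally_generates {n1, n2, n3} H"
    and "I = semigroup_ideal n1 n2 n3"
    and "c1 = (LEAST c. 0 < c \<and> c * n1 \<in> semigroup_gen {n2, n3})"
    and "c2 = (LEAST c. 0 < c \<and> c * n2 \<in> semigroup_gen {n1, n3})"
    and "c3 = (LEAST c. 0 < c \<and> c * n3 \<in> semigroup_gen {n1, n2})"
    and "c1 * n1 = r12 * n2 + r13 * n3"
    and "c2 * n2 = r21 * n1 + r23 * n3"
    and "c3 * n3 = r31 * n1 + r32 * n2"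
    and "r12 \<noteq> 0" "r13 \<noteq> 0" "r21 \<noteq> 0" "r23 \<noteq> 0" "r31 \<noteq> 0" "r32 \<noteq> 0"
    and "c2 < r21 + r23"
  shows "initial_ideal I =
    ideal.span {indet Y_ind ^ r12 * indet Z_ind ^ r13, indet Y_ind ^ c2, indet Z_ind ^ c3}"
proof -
  have "c1 \<le> k" if "0 < k" "k * n1 = p * n2 + q * n3" for k p q
    unfolding assms(7) using that by (rule Least_multiple_le)
  moreover have "c2 \<le> k" if "0 < k" "k * n2 = p * n1 + q * n3" for k p q
    unfolding assms(8) using that by (rule Least_multiple_le)
  moreover have "c3 \<le> k" if "0 < k" "k * n3 = p * n1 + q * n2" for k p q
    unfolding assms(9) using that by (rule Least_multiple_le)
  ultimately interpret three_generator_relations n1 n2 n3 c1 c2 c3 r12 r13 r21 r23 r31 r32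
    using assms(1-3,10-19) by unfold_locales auto
  show ?thesis
    unfolding assms(6) by (rule initial_ideal_eq)
qed

end
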